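(* Let $A\in\mathbb{R}^{m\times n}$ with $m\ge n$ have full rank and nonzero rows, and let $q\ge 1$ be an integer. Consider randomized Kaczmarz with averaging over $q$ threads with probabilities $p_i=\frac{\|A_i\|^2}{\|A\|_F^2}$ and weight matrix $W=\alpha I$. The relaxation parameter $\alpha>0$ which yields the fastest convergence rate guarantee, i.e. which minimizes over $\alpha>0$ the rate constant $$\rho(\alpha)=\sigma_{\max}\left(\left(I-\alpha\frac{A^\top A}{\|A\|_F^2}\right)^2+\frac{\alpha^2}{q}\left(I-\frac{A^\top A}{\|A\|_F^2}\right)\frac{A^\top A}{\|A\|_F^2}\right),$$ is $$\alpha^\star=\begin{cases}\dfrac{q}{1+(q-1)s_{\min}}, & 1-(q-1)(s_{\max}-s_{\min})\ge 0,\\[2ex] \dfrac{2q}{1+(q-1)(s_{\min}+s_{\max})}, & 1-(q-1)(s_{\max}-s_{\min})<0,\end{cases}$$ where $s_{\min}=\frac{\sigma_{\min}^2(A)}{\|A\|_F^2}$ and $s_{\max}=\frac{\sigma_{\max}^2(A)}{\|A\|_F^2}$.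
   Context: $A_i$ denotes the $i$-th row of $A$, $\|\cdot\|$ the Euclidean norm, $\|A\|_F^2=\sum_{i,j}A_{ij}^2$, $I$ the identity matrix, $\sigma_{\max}(\cdot)$ the largest singular value, and $\sigma_{\min}(A)$ the smallest nonzero singular value of $A$ (which, $A$ having full rank with $m\ge n$, is the smallest of its $n$ singular values). Background: randomized Kaczmarz with averaging for a system $Ax=b$ with $W=\alpha I$ is the iteration $x^{k+1}=x^k-\frac{\alpha}{q}\sum_{i\in\tau_k}\frac{A_ix^k-b_i}{\|A_i\|^2}A_i^\top$, where $\tau_k$ consists of $q$ indices drawn independently with replacement with $\mathbb{P}(i=j)=p_j$. With $x^\star$ the least-squares solution, $e^k=x^k-x^\star$ and $r^\star=b-Ax^\star$, the convergence rate guarantee referred to is the bound $\mathbb{E}[\|e^{k+1}\|^2\mid e^k]\le\rho(\alpha)\|e^k\|^2+\frac{\alpha^2\|r^\star\|^2}{q\|A\|_F^2}$, whose rate constant is $\rho(\alpha)$. *)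

theory Defs
  imports "HOL-Analysis.Analysis"
begin

definition frob_norm :: "real^'n^'m \<Rightarrow> real"
  where "frob_norm A = sqrt (\<Sum>i\<in>UNIV. \<Sum>j\<in>UNIV. (A $ i $ j)\<^sup>2)"

text \<open>
  The singular values of A are the square roots of the eigenvalues of the Gram matrix
  \<open>A\<^sup>T A\<close>. For a wide matrix this set always contains 0, also when the rank is maximal; neither the
  largest nor the smallest nonzero singular value depends on that.
\<close>

definition singular_values :: "real^'n^'m \<Rightarrow> real set"
  where "singular_values A =
    {s. 0 \<le> s \<and> (\<exists>v. v \<noteq> 0 \<and> (transpose A ** A) *v v = s\<^sup>2 *\<^sub>R v)}"

definition sigma_max :: "real^'n^'m \<Rightarrow> real"
  where "sigma_max A = Max (singular_values A)"

definition sigma_min :: "real^'n^'m \<Rightarrow> real"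
  where "sigma_min A = Min (singular_values A - {0})"

definition normalized_gram :: "real^'n^'m \<Rightarrow> real^'n^'n"
  where "normalized_gram A = (1 / (frob_norm A)\<^sup>2) *\<^sub>R (transpose A ** A)"

text \<open>
  The constant in the bound
  \<open>E[\<parallel>e\<^sub>k\<^sub>+\<^sub>1\<parallel>\<^sup>2 | e\<^sub>k] \<le> \<rho>(\<alpha>) \<parallel>e\<^sub>k\<parallel>\<^sup>2 + \<alpha>\<^sup>2 \<parallel>r\<parallel>\<^sup>2 / (q \<parallel>A\<parallel>\<^sub>F\<^sup>2)\<close>, with \<open>r\<close> the least-squares residual, for
  randomized Kaczmarz with averaging over \<open>q\<close> threads, row probabilities
  \<open>p\<^sub>i = \<parallel>A\<^sub>i\<parallel>\<^sup>2 / \<parallel>A\<parallel>\<^sub>F\<^sup>2\<close> and weight matrix \<open>W = \<alpha> I\<close>.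
\<close>

definition rka_rate :: "real^'n^'m \<Rightarrow> nat \<Rightarrow> real \<Rightarrow> real"
  where "rka_rate A q \<alpha> =
    (let G = normalized_gram A;
         M = mat 1 - \<alpha> *\<^sub>R G
     in sigma_max (M ** M + (\<alpha>\<^sup>2 / real q) *\<^sub>R ((mat 1 - G) ** G)))"

definition s_min :: "real^'n^'m \<Rightarrow> real"
  where "s_min A = (sigma_min A)\<^sup>2 / (frob_norm A)\<^sup>2"

definition s_max :: "real^'n^'m \<Rightarrow> real"
  where "s_max A = (sigma_max A)\<^sup>2 / (frob_norm A)\<^sup>2"

end

theory Submission
  imports Defs
begin

text \<open>
  The matrix inside \<open>\<rho>(\<alpha>)\<close> is a quadratic polynomial in the symmetric matrix
  \<open>G = A\<^sup>T A / \<parallel>A\<parallel>\<^sub>F\<^sup>2\<close>, whose eigenvalues lie in \<open>(0, 1]\<close>. On an eigenvalue \<open>s\<close> of \<open>G\<close> this polynomial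
  has the nonnegative value \<open>h\<^sub>s(\<alpha>) = 1 - 2 s \<alpha> + s (1 + (q - 1) s) \<alpha>\<^sup>2 / q\<close>, so \<open>\<rho>(\<alpha>)\<close> is the maximum of
  \<open>h\<^sub>s(\<alpha>)\<close> over the spectrum. As \<open>h\<^sub>s(\<alpha>)\<close> is convex in \<open>s\<close>, only \<open>s = s\<^sub>m\<^sub>i\<^sub>n\<close> and \<open>s = s\<^sub>m\<^sub>a\<^sub>x\<close> matter.
  The two parabolas in \<open>\<alpha>\<close> cross at \<open>2 q / (1 + (q - 1) (s\<^sub>m\<^sub>i\<^sub>n + s\<^sub>m\<^sub>a\<^sub>x))\<close>; the minimum of their
  maximum is at the vertex \<open>q / (1 + (q - 1) s\<^sub>m\<^sub>i\<^sub>n)\<close> of the first one if this vertex comes before the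
  crossing, and at the crossing otherwise.
\<close>

section \<open>Eigenvalues of symmetric matrices\<close>

definition eigenvalues :: "real^'n^'n \<Rightarrow> real set"
  where "eigenvalues G = {\<mu>. \<exists>v. v \<noteq> 0 \<and> G *v v = \<mu> *\<^sub>R v}"

text \<open>For small negative \<open>t\<close> the linear term would outweigh the quadratic one.
  This is the first-variation argument for the Rayleigh quotient below.\<close>

lemma quadratic_nonneg_imp_linear_coeff_zero:
  fixes a b :: real
  assumes "a \<ge> 0" "b \<ge> 0" "\<And>t. 0 \<le> 2 * t * a + t\<^sup>2 * b"
  shows "a = 0"
proof (rule ccontr)
  assume "a \<noteq> 0"
  with assms(1) have "a > 0" by simp
  \<comment> \<open>The summand 1 keeps the denominator positive when \<open>b = 0\<close>.\<close>
  define t where "t = - a / (b + 1)"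
  have a_eq: "a = - t * (b + 1)" using assms(2) by (simp add: t_def)
  have "2 * t * a + t\<^sup>2 * b = - t\<^sup>2 * (b + 2)"
    by (subst a_eq) (simp add: power2_eq_square algebra_simps)
  moreover have "t \<noteq> 0" using \<open>a > 0\<close> assms(2) by (simp add: t_def)
  then have "t\<^sup>2 * (b + 2) > 0" using assms(2) by simp
  ultimately show False using assms(3)[of t] by simp
qed

text \<open>
  A maximiser \<open>v\<close> of the Rayleigh quotient on the subspace is an eigenvector: the form
  \<open>\<mu> \<parallel>x\<parallel>\<^sup>2 - x \<bullet> f x\<close> is positive semidefinite there and vanishes at \<open>v\<close>.
\<close>

lemma selfadjoint_eigenvector_in_invariant_subspace:
  fixes f :: "'a::euclidean_space \<Rightarrow> 'a"
  assumes "linear f" and sa: "\<And>x y. f x \<bullet> y = x \<bullet> f y"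
    and "subspace S" and inv: "\<And>x. x \<in> S \<Longrightarrow> f x \<in> S" and "\<exists>x\<in>S. x \<noteq> 0"
  obtains v \<mu> where "v \<in> S" "v \<noteq> 0" "f v = \<mu> *\<^sub>R v"
proof -
  interpret linear f by fact
  obtain x0 where x0: "x0 \<in> S" "x0 \<noteq> 0" using assms(5) by blast
  let ?K = "S \<inter> sphere 0 1"
  have "compact ?K"
    using closed_subspace[OF \<open>subspace S\<close>] by (simp add: closed_Int_compact)
  moreover have "x0 /\<^sub>R norm x0 \<in> ?K"
    using x0 \<open>subspace S\<close> by (simp add: subspace_scale)
  then have "?K \<noteq> {}" by blast
  moreover have "continuous_on ?K (\<lambda>x. x \<bullet> f x)"
    by (intro continuous_intros linear_continuous_on linear_conv_bounded_linear[THEN iffD1] \<open>linear f\<close>)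
  ultimately obtain v where v: "v \<in> ?K" and vmax: "\<And>x. x \<in> ?K \<Longrightarrow> x \<bullet> f x \<le> v \<bullet> f v"
    using continuous_attains_sup by meson
  define \<mu> where "\<mu> = v \<bullet> f v"
  have vv: "v \<in> S" "v \<bullet> v = 1" using v by (auto simp: norm_eq_1)
  have le: "x \<bullet> f x \<le> \<mu> * (x \<bullet> x)" if "x \<in> S" for x
  proof (cases "x = 0")
    case False
    then have "x /\<^sub>R norm x \<in> ?K"
      using that \<open>subspace S\<close> by (simp add: subspace_scale)
    from vmax[OF this] have "(x \<bullet> f x) / (norm x)\<^sup>2 \<le> \<mu>"
      by (simp add: \<mu>_def scale power2_eq_square field_simps)
    then show ?thesis
      using False by (simp add: field_simps power2_norm_eq_inner)
  qed (simp add: zero)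
  \<comment> \<open>The residual of the eigenvector equation. Perturbing \<open>v\<close> in the
    direction of \<open>w\<close> itself forces \<open>w\<close> to vanish.\<close>
  define w where "w = \<mu> *\<^sub>R v - f v"
  have wS: "w \<in> S"
    using vv inv \<open>subspace S\<close> by (simp add: w_def subspace_diff subspace_scale)
  have "0 \<le> 2 * t * (w \<bullet> w) + t\<^sup>2 * (\<mu> * (w \<bullet> w) - w \<bullet> f w)" for t
  proof -
    have "v + t *\<^sub>R w \<in> S"
      using vv wS \<open>subspace S\<close> by (simp add: subspace_add subspace_scale)
    from le[OF this]
    have "0 \<le> \<mu> * ((v + t *\<^sub>R w) \<bullet> (v + t *\<^sub>R w)) - (v + t *\<^sub>R w) \<bullet> f (v + t *\<^sub>R w)"
      by simp
    also have "\<dots> = 2 * t * (\<mu> * (w \<bullet> v) - w \<bullet> f v) + t\<^sup>2 * (\<mu> * (w \<bullet> w) - w \<bullet> f w)"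
      using sa[of v w] vv(2)
      by (simp add: add scale inner_add_left inner_add_right inner_commute \<mu>_def
          power2_eq_square algebra_simps)
    also have "\<mu> * (w \<bullet> v) - w \<bullet> f v = w \<bullet> w"
      by (simp add: w_def inner_diff_right)
    finally show ?thesis .
  qed
  then have "w \<bullet> w = 0"
    using le[OF wS]
    by (intro quadratic_nonneg_imp_linear_coeff_zero[of _ "\<mu> * (w \<bullet> w) - w \<bullet> f w"]) auto
  then have "f v = \<mu> *\<^sub>R v" by (simp add: w_def)
  then show thesis using that vv by force
qed

lemma symmetric_matrix_inner:
  fixes G :: "real^'n^'n"
  assumes "transpose G = G"
  shows "(G *v x) \<bullet> y = x \<bullet> (G *v y)"
  by (metis assms dot_lmul_matrix transpose_matrix_vector)

text \<open>By symmetry, eigenvectors for different eigenvalues are orthogonal; being nonzero, they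
  are independent, so there are finitely many.\<close>

lemma finite_eigenvalues:
  fixes G :: "real^'n^'n"
  assumes "transpose G = G"
  shows "finite (eigenvalues G)"
proof -
  have "\<forall>\<mu>\<in>eigenvalues G. \<exists>v. v \<noteq> 0 \<and> G *v v = \<mu> *\<^sub>R v"
    by (simp add: eigenvalues_def)
  then obtain v where v: "\<And>\<mu>. \<mu> \<in> eigenvalues G \<Longrightarrow> v \<mu> \<noteq> 0 \<and> G *v v \<mu> = \<mu> *\<^sub>R v \<mu>"
    by metis
  have orth: "v \<mu> \<bullet> v \<nu> = 0" if "\<mu> \<in> eigenvalues G" "\<nu> \<in> eigenvalues G" "\<mu> \<noteq> \<nu>" for \<mu> \<nu>
    using symmetric_matrix_inner[OF assms, of "v \<mu>" "v \<nu>"] v[OF that(1)] v[OF that(2)] that(3)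
    by simp
  have "inj_on v (eigenvalues G)"
    by (rule inj_onI) (metis orth v inner_eq_zero_iff)
  moreover have "pairwise orthogonal (v ` eigenvalues G)"
    using orth by (fastforce simp: pairwise_def orthogonal_def)
  then have "independent (v ` eigenvalues G)"
    using v by (intro pairwise_orthogonal_independent) auto
  then have "finite (v ` eigenvalues G)"
    by (rule independent_imp_finite)
  ultimately show ?thesis by (simp add: finite_image_iff)
qed

lemma eigenvalues_nonempty:
  fixes G :: "real^'n^'n"
  assumes "transpose G = G"
  shows "eigenvalues G \<noteq> {}"
proof -
  have "\<exists>x\<in>UNIV. x \<noteq> (0::real^'n)"
    by (metis UNIV_I axis_eq_0_iff zero_neq_one)
  then obtain v \<mu> where "v \<noteq> 0" "G *v v = \<mu> *\<^sub>R v"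
    using selfadjoint_eigenvector_in_invariant_subspace[of "(*v) G" UNIV]
      symmetric_matrix_inner[OF assms] by auto
  then show ?thesis by (auto simp: eigenvalues_def)
qed

lemma matrix_scaleR_vector_mult: "(k *\<^sub>R M) *v x = k *\<^sub>R (M *v x)"
  for M :: "real^'n^'m"
  by (simp add: scaleR_matrix_vector_assoc)

lemma eigenvalues_scaleR:
  assumes "k \<noteq> 0"
  shows "eigenvalues (k *\<^sub>R G) = (*) k ` eigenvalues G"
proof
  show "(*) k ` eigenvalues G \<subseteq> eigenvalues (k *\<^sub>R G)"
    by (force simp: eigenvalues_def matrix_scaleR_vector_mult)
  show "eigenvalues (k *\<^sub>R G) \<subseteq> (*) k ` eigenvalues G"
  proof
    fix \<mu> assume "\<mu> \<in> eigenvalues (k *\<^sub>R G)"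
    then obtain v where v: "v \<noteq> 0" "k *\<^sub>R (G *v v) = \<mu> *\<^sub>R v"
      by (auto simp: eigenvalues_def matrix_scaleR_vector_mult)
    then have "G *v v = (\<mu> / k) *\<^sub>R v"
      using assms by (metis (no_types) divide_inverse_commute scaleR_scaleR
          left_inverse scaleR_one)
    then have "\<mu> / k \<in> eigenvalues G" using v by (auto simp: eigenvalues_def)
    then show "\<mu> \<in> (*) k ` eigenvalues G"
      using assms by (intro image_eqI[of _ _ "\<mu> / k"]) auto
  qed
qed

section \<open>Singular values\<close>

lemma singular_values_eq: "singular_values A = {s. 0 \<le> s \<and> s\<^sup>2 \<in> eigenvalues (transpose A ** A)}"
  by (simp add: singular_values_def eigenvalues_def)

lemma transpose_gram: "transpose (transpose A ** A) = transpose A ** (A :: real^'n^'m)"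
  by (simp add: matrix_transpose_mul)

text \<open>Pairing the eigenvector equation with \<open>v\<close> gives this. It later yields the
  sign of Gram eigenvalues and both bounds on the singular values.\<close>

lemma gram_eigenvalue_Rayleigh:
  fixes A :: "real^'n^'m"
  assumes "\<mu> \<in> eigenvalues (transpose A ** A)"
  obtains v where "v \<noteq> 0" "\<mu> * (norm v)\<^sup>2 = (norm (A *v v))\<^sup>2"
proof -
  obtain v where v: "v \<noteq> 0" "(transpose A ** A) *v v = \<mu> *\<^sub>R v"
    using assms by (auto simp: eigenvalues_def)
  have "(norm (A *v v))\<^sup>2 = ((transpose A ** A) *v v) \<bullet> v"
    by (simp add: power2_norm_eq_inner dot_lmul_matrix flip: matrix_vector_mul_assoc)
  with v that show thesis by (simp add: power2_norm_eq_inner)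
qed

lemma eigenvalues_gram_eq: "eigenvalues (transpose A ** A) = (\<lambda>s. s\<^sup>2) ` singular_values A"
  for A :: "real^'n^'m"
proof -
  have "\<mu> \<ge> 0" if \<mu>: "\<mu> \<in> eigenvalues (transpose A ** A)" for \<mu>
  proof -
    obtain v where "v \<noteq> 0" "\<mu> * (norm v)\<^sup>2 = (norm (A *v v))\<^sup>2"
      using gram_eigenvalue_Rayleigh[OF \<mu>] .
    then show ?thesis
      by (metis zero_le_mult_iff zero_le_power2 not_less zero_less_norm_iff zero_less_power2
          norm_eq_zero order_antisym_conv)
  qed
  then show ?thesis
    by (force simp: singular_values_eq intro: image_eqI[of \<mu> _ "sqrt \<mu>" for \<mu>])
qed

lemma finite_singular_values: "finite (singular_values A)"
  for A :: "real^'n^'m"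
proof -
  have "inj_on (\<lambda>s. s\<^sup>2) (singular_values A)"
    by (rule inj_onI) (auto simp: singular_values_def)
  then show ?thesis
    using finite_eigenvalues[OF transpose_gram, of A]
    by (simp add: eigenvalues_gram_eq finite_image_iff)
qed

lemma singular_values_nonempty: "singular_values A \<noteq> {}"
  for A :: "real^'n^'m"
  using eigenvalues_nonempty[OF transpose_gram, of A] by (auto simp: eigenvalues_gram_eq)

text \<open>\<open>P\<close> is symmetric and commutes with \<open>G\<close>, so each eigenspace of
  \<open>P ** P\<close> is invariant under \<open>G\<close> and contains an eigenvector of
  \<open>G\<close>. This replaces a full diagonalisation; nonnegativity of \<open>f\<close> turns
  \<open>\<bar>f \<mu>\<bar>\<close> into \<open>f \<mu>\<close>.\<close>

lemma singular_values_quadratic: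
  fixes G :: "real^'n^'n" and c d :: real
  defines "P \<equiv> mat 1 + c *\<^sub>R G + d *\<^sub>R (G ** G)"
    and "f \<equiv> \<lambda>\<mu>. 1 + c * \<mu> + d * \<mu>\<^sup>2"
  assumes sym: "transpose G = G" and nonneg: "\<And>\<mu>. \<mu> \<in> eigenvalues G \<Longrightarrow> f \<mu> \<ge> 0"
  shows "singular_values P = f ` eigenvalues G"
proof -
  have P: "P *v x = x + c *\<^sub>R (G *v x) + d *\<^sub>R (G *v (G *v x))" for x
    by (simp add: P_def matrix_vector_mult_add_rdistrib matrix_scaleR_vector_mult
        matrix_vector_mul_assoc)
  have "(P *v x) \<bullet> y = x \<bullet> (P *v y)" for x y
    by (simp add: P inner_add_left inner_add_right symmetric_matrix_inner[OF sym])
  then have "transpose P *v x = P *v x" for x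
    by (metis dot_lmul_matrix transpose_matrix_vector vector_eq_rdot)
  then have PP: "(transpose P ** P) *v x = P *v (P *v x)" for x
    by (metis matrix_vector_mul_assoc)
  have GP: "G *v (P *v x) = P *v (G *v x)" for x
    by (simp add: P matrix_vector_right_distrib matrix_vector_mult_scaleR)
  have Pv: "P *v v = f \<mu> *\<^sub>R v" if "G *v v = \<mu> *\<^sub>R v" for v \<mu>
    by (simp add: P that f_def matrix_vector_mult_scaleR scaleR_left_distrib power2_eq_square)
  have PPv: "P *v (P *v v) = (f \<mu>)\<^sup>2 *\<^sub>R v" if "G *v v = \<mu> *\<^sub>R v" for v \<mu>
    by (simp add: Pv[OF that] matrix_vector_mult_scaleR power2_eq_square)
  show ?thesis
  proof
    show "f ` eigenvalues G \<subseteq> singular_values P"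
      using nonneg by (auto simp: singular_values_def PP eigenvalues_def dest: PPv)
    show "singular_values P \<subseteq> f ` eigenvalues G"
    proof
      fix s assume "s \<in> singular_values P"
      then obtain u where s: "s \<ge> 0" "u \<noteq> 0" "P *v (P *v u) = s\<^sup>2 *\<^sub>R u"
        unfolding singular_values_def PP by blast
      let ?E = "{x. P *v (P *v x) = s\<^sup>2 *\<^sub>R x}"
      have "subspace ?E"
        by (simp add: subspace_def matrix_vector_right_distrib matrix_vector_mult_scaleR
            scaleR_right_distrib)
      moreover have "G *v x \<in> ?E" if "x \<in> ?E" for x
        using that by (simp add: matrix_vector_mult_scaleR flip: GP)
      moreover have "\<exists>x\<in>?E. x \<noteq> 0" using s by blast
      ultimately obtain v \<mu> where v: "v \<in> ?E" "v \<noteq> 0" "G *v v = \<mu> *\<^sub>R v"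
        by (rule selfadjoint_eigenvector_in_invariant_subspace
            [OF matrix_vector_mul_linear symmetric_matrix_inner[OF sym]])
      then have \<mu>: "\<mu> \<in> eigenvalues G" by (auto simp: eigenvalues_def)
      have "(f \<mu>)\<^sup>2 = s\<^sup>2" using PPv[OF v(3)] v(1,2) by simp
      then have "s = f \<mu>" using s(1) nonneg[OF \<mu>] by simp
      then show "s \<in> f ` eigenvalues G" using \<mu> by blast
    qed
  qed
qed

section \<open>The rate constant\<close>

text \<open>Cauchy-Schwarz in each row. It will bound the normalized eigenvalues by 1.\<close>

lemma norm_matrix_vector_le_frob: "norm (A *v v) \<le> frob_norm A * norm v"
proof -
  have "(norm (A *v v))\<^sup>2 = (\<Sum>i\<in>UNIV. (A $ i \<bullet> v)\<^sup>2)"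
    unfolding power2_norm_eq_inner inner_vec_def[of "A *v v"]
    by (simp add: matrix_mult_dot power2_eq_square)
  also have "\<dots> \<le> (\<Sum>i\<in>UNIV. (A $ i \<bullet> A $ i) * (v \<bullet> v))"
    by (intro sum_mono Cauchy_Schwarz_ineq)
  also have "\<dots> = (\<Sum>i\<in>UNIV. \<Sum>j\<in>UNIV. (A $ i $ j)\<^sup>2) * (norm v)\<^sup>2"
    unfolding power2_norm_eq_inner inner_vec_def[of "A $ _"]
    by (simp add: power2_eq_square sum_distrib_right)
  also have "\<dots> = (frob_norm A * norm v)\<^sup>2"
    by (simp add: frob_norm_def power_mult_distrib sum_nonneg)
  finally show ?thesis
    by (rule power2_le_imp_le) (simp add: frob_norm_def sum_nonneg)
qed

text \<open>This is \<open>h\<^sub>s(\<alpha>)\<close>, with the eigenvalue last so that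
  \<open>eigen_rate q \<alpha>\<close> can be mapped over the spectrum.\<close>

definition eigen_rate :: "nat \<Rightarrow> real \<Rightarrow> real \<Rightarrow> real"
  where "eigen_rate q \<alpha> s = 1 - 2 * s * \<alpha> + s * (1 + (real q - 1) * s) / real q * \<alpha>\<^sup>2"

text \<open>A square plus a nonnegative multiple of \<open>(1 - s) * s\<close>.\<close>

lemma eigen_rate_nonneg:
  assumes "q \<ge> 1" "0 \<le> s" "s \<le> 1"
  shows "eigen_rate q \<alpha> s \<ge> 0"
proof -
  have "eigen_rate q \<alpha> s = (1 - \<alpha> * s)\<^sup>2 + \<alpha>\<^sup>2 / real q * ((1 - s) * s)"
    using assms(1) by (simp add: eigen_rate_def power2_eq_square field_simps)
  also have "\<dots> \<ge> 0" using assms by simp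
  finally show ?thesis .
qed

text \<open>The last factor changes sign where the parabolas of \<open>s\<close> and
  \<open>t\<close> cross.\<close>

lemma eigen_rate_diff:
  assumes "q \<ge> 1"
  shows "eigen_rate q \<alpha> s - eigen_rate q \<alpha> t
    = (s - t) * \<alpha> * ((1 + (real q - 1) * (s + t)) * \<alpha> - 2 * real q) / real q"
  using assms by (simp add: eigen_rate_def power2_eq_square field_simps)

text \<open>Convexity in \<open>s\<close> in three-point form: the sign factor of a difference grows
  with the sum of its two eigenvalues, so if the chord from \<open>a\<close> to \<open>s\<close>
  rises, the one from \<open>s\<close> to \<open>b\<close> does not fall.\<close>

lemma eigen_rate_le_max:
  assumes "q \<ge> 1" "\<alpha> > 0" "a \<le> s" "s \<le> b"
  shows "eigen_rate q \<alpha> s \<le> max (eigen_rate q \<alpha> a) (eigen_rate q \<alpha> b)"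
proof (cases "(1 + (real q - 1) * (s + a)) * \<alpha> - 2 * real q \<le> 0")
  case True
  have "eigen_rate q \<alpha> s - eigen_rate q \<alpha> a \<le> 0"
    unfolding eigen_rate_diff[OF assms(1)] using True assms
    by (intro divide_nonpos_nonneg mult_nonneg_nonpos) auto
  then show ?thesis by simp
next
  case False
  have "(1 + (real q - 1) * (s + a)) * \<alpha> \<le> (1 + (real q - 1) * (b + s)) * \<alpha>"
    using assms by (intro mult_right_mono add_left_mono mult_left_mono) auto
  then have "(1 + (real q - 1) * (b + s)) * \<alpha> - 2 * real q \<ge> 0"
    using False by linarith
  then have "eigen_rate q \<alpha> b - eigen_rate q \<alpha> s \<ge> 0"
    unfolding eigen_rate_diff[OF assms(1)] using assms
    by (intro divide_nonneg_nonneg mult_nonneg_nonneg) auto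
  then show ?thesis by simp
qed

lemma rka_rate_eq_Max:
  fixes A :: "real^'n^'m"
  assumes "q \<ge> 1" and "\<And>\<mu>. \<mu> \<in> eigenvalues (normalized_gram A) \<Longrightarrow> 0 \<le> \<mu> \<and> \<mu> \<le> 1"
  shows "rka_rate A q \<alpha> = Max (eigen_rate q \<alpha> ` eigenvalues (normalized_gram A))"
proof -
  define G where "G = normalized_gram A"
  define M where "M = mat 1 - \<alpha> *\<^sub>R G"
  \<comment> \<open>The coefficients of \<open>G\<close> and \<open>G ** G\<close> after expanding
    the matrix in the rate.\<close>
  let ?c = "\<alpha>\<^sup>2 / real q - 2 * \<alpha>" and ?d = "\<alpha>\<^sup>2 * (1 - 1 / real q)"
  have sym: "transpose G = G"
    unfolding G_def normalized_gram_def transpose_scalar transpose_gram ..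
  have "M ** M + (\<alpha>\<^sup>2 / real q) *\<^sub>R ((mat 1 - G) ** G) = mat 1 + ?c *\<^sub>R G + ?d *\<^sub>R (G ** G)"
    unfolding matrix_eq M_def
    by (auto simp: matrix_vector_mult_add_rdistrib matrix_vector_mult_diff_rdistrib
        matrix_vector_mult_diff_distrib matrix_scaleR_vector_mult matrix_vector_mult_scaleR
        power2_eq_square algebra_simps simp flip: matrix_vector_mul_assoc scaleR_2)
  moreover have rate: "1 + ?c * \<mu> + ?d * \<mu>\<^sup>2 = eigen_rate q \<alpha> \<mu>" for \<mu>
    using assms(1) by (simp add: eigen_rate_def power2_eq_square field_simps)
  ultimately show ?thesis
    using singular_values_quadratic[OF sym, of ?c ?d] assms eigen_rate_nonneg
    by (simp add: rka_rate_def Let_def sigma_max_def G_def M_def)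
qed

text \<open>Full column rank makes \<open>A\<close> injective, which excludes the singular value 0;
  the Frobenius bound then puts the normalized spectrum into the interval from 0 to 1, and convexity
  leaves only its two ends.\<close>

lemma rka_rate_eq_max:
  fixes A :: "real^'n^'m"
  assumes "rank A = CARD('n)" "q \<ge> 1"
  shows "0 < s_min A" "s_min A \<le> s_max A"
    and "\<And>\<alpha>. \<alpha> > 0 \<Longrightarrow>
      rka_rate A q \<alpha> = max (eigen_rate q \<alpha> (s_min A)) (eigen_rate q \<alpha> (s_max A))"
proof -
  let ?S = "singular_values A" and ?F = "(frob_norm A)\<^sup>2"
  let ?E = "eigenvalues (normalized_gram A)"
  have inj: "A *v v \<noteq> 0" if "v \<noteq> 0" for v
    using assms(1) that by (metis full_rank_injective injD matrix_vector_mult_0_right)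
  have F: "?F > 0"
  proof -
    obtain v :: "real^'n" where "v \<noteq> 0" by (metis axis_eq_0_iff zero_neq_one)
    then show ?thesis
      using inj[of v] norm_matrix_vector_le_frob[of A v] by auto
  qed
  have bounds: "0 < s \<and> s\<^sup>2 \<le> ?F" if "s \<in> ?S" for s
  proof -
    have "s\<^sup>2 \<in> eigenvalues (transpose A ** A)" "s \<ge> 0"
      using that by (auto simp: singular_values_eq)
    then obtain v where v: "v \<noteq> 0" "s\<^sup>2 * (norm v)\<^sup>2 = (norm (A *v v))\<^sup>2"
      using gram_eigenvalue_Rayleigh by blast
    have "s \<noteq> 0" using v inj[of v] by auto
    moreover have "s\<^sup>2 * (norm v)\<^sup>2 \<le> ?F * (norm v)\<^sup>2"
      using v(2) power_mono[OF norm_matrix_vector_le_frob[of A v], of 2]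
      by (simp add: power_mult_distrib)
    then have "s\<^sup>2 \<le> ?F" using v(1) by simp
    ultimately show ?thesis using \<open>s \<ge> 0\<close> by simp
  qed
  have E: "?E = (\<lambda>s. s\<^sup>2 / ?F) ` ?S"
    using F unfolding normalized_gram_def
    by (subst eigenvalues_scaleR) (auto simp: eigenvalues_gram_eq image_image)
  have fin: "finite ?S" "?S \<noteq> {}"
    by (rule finite_singular_values, rule singular_values_nonempty)
  \<comment> \<open>All singular values are positive, so removing 0 changes nothing.\<close>
  have min: "sigma_min A = Min ?S"
    using bounds by (metis Diff_empty Diff_insert0 less_irrefl sigma_min_def)
  have mem: "sigma_min A \<in> ?S" "sigma_max A \<in> ?S"
    using fin by (simp_all add: min sigma_max_def)
  then have sE: "s_min A \<in> ?E" "s_max A \<in> ?E"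
    by (auto simp: E s_min_def s_max_def)
  have between: "s_min A \<le> \<mu> \<and> \<mu> \<le> s_max A" if \<mu>: "\<mu> \<in> ?E" for \<mu>
  proof -
    obtain s where s: "s \<in> ?S" "\<mu> = s\<^sup>2 / ?F" using \<mu> unfolding E by blast
    then have "sigma_min A \<le> s" "s \<le> sigma_max A"
      using fin by (simp_all add: min sigma_max_def)
    then show ?thesis
      using bounds[OF s(1)] bounds[OF mem(1)]
      by (auto simp: s(2) s_min_def s_max_def intro!: divide_right_mono power_mono)
  qed
  show "0 < s_min A" using bounds[OF mem(1)] F by (simp add: s_min_def)
  show "s_min A \<le> s_max A" using between sE by blast
  fix \<alpha> :: real assume "\<alpha> > 0"
  have "rka_rate A q \<alpha> = Max (eigen_rate q \<alpha> ` ?E)"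
    using bounds F by (intro rka_rate_eq_Max assms) (auto simp: E)
  also have "\<dots> = max (eigen_rate q \<alpha> (s_min A)) (eigen_rate q \<alpha> (s_max A))"
  proof (rule Max_eqI)
    show "finite (eigen_rate q \<alpha> ` ?E)" using fin by (simp add: E)
    show "y \<le> max (eigen_rate q \<alpha> (s_min A)) (eigen_rate q \<alpha> (s_max A))"
      if "y \<in> eigen_rate q \<alpha> ` ?E" for y
      using that between eigen_rate_le_max[OF assms(2) \<open>\<alpha> > 0\<close>] by blast
    show "max (eigen_rate q \<alpha> (s_min A)) (eigen_rate q \<alpha> (s_max A)) \<in> eigen_rate q \<alpha> ` ?E"
      using sE by (simp add: max_def)
  qed
  finally show "rka_rate A q \<alpha> = max (eigen_rate q \<alpha> (s_min A)) (eigen_rate q \<alpha> (s_max A))" .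
qed

section \<open>Optimising the relaxation parameter\<close>

text \<open>The last factor compares the mean of \<open>\<alpha>\<close> and \<open>\<beta>\<close>
  with the vertex \<open>q / (1 + (q - 1) * s)\<close>.\<close>

lemma eigen_rate_alpha_diff:
  assumes "q \<ge> 1"
  shows "eigen_rate q \<beta> s - eigen_rate q \<alpha> s
    = s / real q * (\<beta> - \<alpha>) * ((1 + (real q - 1) * s) * (\<alpha> + \<beta>) - 2 * real q)"
  using assms by (simp add: eigen_rate_def power2_eq_square field_simps)

text \<open>The last hypothesis says, free of division, that \<open>\<alpha>\<close> is not beyond
  the vertex.\<close>

lemma eigen_rate_strict_decreasing:
  assumes "q \<ge> 1" "s > 0" "\<beta> < \<alpha>" "(1 + (real q - 1) * s) * \<alpha> \<le> real q"
  shows "eigen_rate q \<alpha> s < eigen_rate q \<beta> s"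
proof -
  have "1 + (real q - 1) * s > 0" using assms by (simp add: add_pos_nonneg)
  then have "(1 + (real q - 1) * s) * \<beta> < (1 + (real q - 1) * s) * \<alpha>"
    using assms(3) by simp
  then have "(1 + (real q - 1) * s) * (\<alpha> + \<beta>) - 2 * real q < 0"
    using assms(4) by (simp add: distrib_left)
  moreover have "s / real q * (\<beta> - \<alpha>) < 0"
    using assms by (intro mult_pos_neg) auto
  ultimately have "eigen_rate q \<beta> s - eigen_rate q \<alpha> s > 0"
    unfolding eigen_rate_alpha_diff[OF assms(1)] by (rule mult_neg_neg[rotated])
  then show ?thesis by simp
qed

lemma eigen_rate_strict_increasing:
  assumes "q \<ge> 1" "s > 0" "\<alpha> < \<beta>" "real q \<le> (1 + (real q - 1) * s) * \<alpha>"
  shows "eigen_rate q \<alpha> s < eigen_rate q \<beta> s"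
proof -
  have "1 + (real q - 1) * s > 0" using assms by (simp add: add_pos_nonneg)
  then have "(1 + (real q - 1) * s) * \<alpha> < (1 + (real q - 1) * s) * \<beta>"
    using assms(3) by simp
  then have "(1 + (real q - 1) * s) * (\<alpha> + \<beta>) - 2 * real q > 0"
    using assms(4) by (simp add: distrib_left)
  moreover have "s / real q * (\<beta> - \<alpha>) > 0"
    using assms by simp
  ultimately have "eigen_rate q \<beta> s - eigen_rate q \<alpha> s > 0"
    unfolding eigen_rate_alpha_diff[OF assms(1)] by (rule mult_pos_pos[rotated])
  then show ?thesis by simp
qed

text \<open>The inequality is strict so that the minimiser comes out unique.\<close>

lemma max_eigen_rate_strict_min:
  fixes a b :: real and q :: nat
  assumes q: "q \<ge> 1" and a: "0 < a" and ab: "a \<le> b"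
  defines "\<alpha> \<equiv> if 1 - (real q - 1) * (b - a) \<ge> 0 then real q / (1 + (real q - 1) * a)
    else 2 * real q / (1 + (real q - 1) * (a + b))"
  shows "\<alpha> > 0"
    and "\<beta> > 0 \<Longrightarrow> \<beta> \<noteq> \<alpha> \<Longrightarrow>
      max (eigen_rate q \<alpha> a) (eigen_rate q \<alpha> b) < max (eigen_rate q \<beta> a) (eigen_rate q \<beta> b)"
proof -
  let ?r = "real q - 1"
  have r: "?r \<ge> 0" using q by simp
  have pos: "1 + ?r * a > 0" "1 + ?r * (a + b) > 0"
    using r a ab by (auto intro!: add_pos_nonneg)
  show \<alpha>0: "\<alpha> > 0" using pos q by (simp add: \<alpha>_def)
  assume "\<beta> > 0" and ne: "\<beta> \<noteq> \<alpha>"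
  show "max (eigen_rate q \<alpha> a) (eigen_rate q \<alpha> b) < max (eigen_rate q \<beta> a) (eigen_rate q \<beta> b)"
  proof (cases "1 - ?r * (b - a) \<ge> 0")
    case True
    then have \<alpha>: "\<alpha> = real q / (1 + ?r * a)" by (simp add: \<alpha>_def)
    then have vertex: "(1 + ?r * a) * \<alpha> = real q" using pos by simp
    \<comment> \<open>The case condition rearranged: the vertex for \<open>a\<close> is not beyond
      the crossing, so at \<open>\<alpha>\<close> the parabola of \<open>a\<close> attains the
      maximum.\<close>
    have "(1 + ?r * (b + a)) * \<alpha> \<le> (2 * (1 + ?r * a)) * \<alpha>"
      using True \<alpha>0 by (intro mult_right_mono) (auto simp: algebra_simps)
    then have "(1 + ?r * (b + a)) * \<alpha> - 2 * real q \<le> 0"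
      by (simp only: mult.assoc vertex diff_le_0_iff_le)
    then have "eigen_rate q \<alpha> b - eigen_rate q \<alpha> a \<le> 0"
      unfolding eigen_rate_diff[OF q] using ab \<alpha>0
      by (intro divide_nonpos_nonneg mult_nonneg_nonpos) auto
    moreover have "eigen_rate q \<alpha> a < eigen_rate q \<beta> a"
    proof (cases "\<beta> < \<alpha>")
      case True
      then show ?thesis using eigen_rate_strict_decreasing[OF q a True] vertex by simp
    next
      case False
      then show ?thesis using eigen_rate_strict_increasing[OF q a, of \<alpha> \<beta>] vertex ne by simp
    qed
    ultimately show ?thesis by simp
  next
    case False
    then have "\<alpha> = 2 * real q / (1 + ?r * (a + b))" by (simp add: \<alpha>_def)
    then have crossing: "(1 + ?r * (a + b)) * \<alpha> = 2 * real q" using pos by simp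
    then have eq: "eigen_rate q \<alpha> a = eigen_rate q \<alpha> b"
      using eigen_rate_diff[OF q, of \<alpha> a b] by simp
    show ?thesis
    proof (cases "\<beta> < \<alpha>")
      case True
      \<comment> \<open>Now the crossing precedes the vertex for \<open>a\<close>, so moving left
        raises that parabola.\<close>
      have "(2 * (1 + ?r * a)) * \<alpha> \<le> (1 + ?r * (a + b)) * \<alpha>"
        using False \<alpha>0 by (intro mult_right_mono) (auto simp: algebra_simps)
      then have "(1 + ?r * a) * \<alpha> \<le> real q" by (simp only: mult.assoc crossing)
      from eigen_rate_strict_decreasing[OF q a True this] eq show ?thesis by simp
    next
      case ge: False
      \<comment> \<open>As \<open>a \<le> b\<close>, the crossing is not before the vertex for
        \<open>b\<close>, so moving right raises the parabola of \<open>b\<close>.\<close>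
      have "(1 + ?r * (a + b)) * \<alpha> \<le> (2 * (1 + ?r * b)) * \<alpha>"
        using mult_left_mono[OF ab r] \<alpha>0 by (intro mult_right_mono) (auto simp: algebra_simps)
      then have "real q \<le> (1 + ?r * b) * \<alpha>" by (simp only: mult.assoc crossing)
      then have "eigen_rate q \<alpha> b < eigen_rate q \<beta> b"
        using eigen_rate_strict_increasing[OF q, of b \<alpha> \<beta>] a ab ge ne by simp
      with eq show ?thesis by simp
    qed
  qed
qed

text \<open>Equality with a singleton expresses both existence and uniqueness of the minimiser; both
  inclusions follow from one strict comparison.\<close>

theorem theorem2:
  fixes A :: "real^'n^'m" and q :: nat
  assumes "CARD('m) \<ge> CARD('n)"
    and "rank A = CARD('n)"
    and "\<And>i. row i A \<noteq> 0"
    and "q \<ge> 1"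
  shows "{\<alpha>. is_arg_min (rka_rate A q) (\<lambda>\<alpha>. \<alpha> > 0) \<alpha>} =
    {if 1 - (real q - 1) * (s_max A - s_min A) \<ge> 0
     then real q / (1 + (real q - 1) * s_min A)
     else 2 * real q / (1 + (real q - 1) * (s_min A + s_max A))}"
    (is "_ = {?\<alpha>}")
proof -
  note rate = rka_rate_eq_max[OF assms(2,4)]
  have pos: "?\<alpha> > 0"
    by (rule max_eigen_rate_strict_min(1)[OF assms(4) rate(1,2)])
  have less: "rka_rate A q ?\<alpha> < rka_rate A q \<beta>" if "\<beta> > 0" "\<beta> \<noteq> ?\<alpha>" for \<beta>
    unfolding rate(3)[OF pos] rate(3)[OF that(1)]
    by (rule max_eigen_rate_strict_min(2)[OF assms(4) rate(1,2) that])
  show ?thesis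
  proof (intro set_eqI iffI)
    fix \<beta> assume "\<beta> \<in> {\<alpha>. is_arg_min (rka_rate A q) (\<lambda>\<alpha>. \<alpha> > 0) \<alpha>}"
    then have "\<beta> > 0" "\<not> rka_rate A q ?\<alpha> < rka_rate A q \<beta>"
      using pos by (auto simp only: is_arg_min_def mem_Collect_eq)
    then show "\<beta> \<in> {?\<alpha>}" using less by blast
  next
    fix \<beta> assume "\<beta> \<in> {?\<alpha>}"
    then have "\<beta> = ?\<alpha>" by (rule singletonD)
    moreover have "is_arg_min (rka_rate A q) (\<lambda>\<alpha>. \<alpha> > 0) ?\<alpha>"
      unfolding is_arg_min_def using pos less by (metis less_asym less_irrefl)
    ultimately show "\<beta> \<in> {\<alpha>. is_arg_min (rka_rate A q) (\<lambda>\<alpha>. \<alpha> > 0) \<alpha>}"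
      by (simp only: mem_Collect_eq)
  qed
qed

end
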